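(* The strict LF-space $\mathrm{VMO}_c(\mathbf{R}^d)$ is not a Montel space, and neither is its subspace $\mathrm{L}^\infty(\mathbf{R}^d)\cap\mathrm{VMO}_c(\mathbf{R}^d)$.
   Context: $\mathrm{VMO}(\mathbf{R}^d)$ is the closure of $\mathrm{C}_c(\mathbf{R}^d)$ in the norm $\|f\|_{\mathrm{BMO}}=\sup_B\frac1{|B|}\int_B|f-f_B|\,dx$ (sup over balls, $f_B$ the mean). For compact $K$, $\mathrm{VMO}_K(\mathbf{R}^d)=\{\varphi\in\mathrm{VMO}(\mathbf{R}^d):\operatorname{supp}\varphi\subseteq K\}$ is a Banach space with the $\mathrm{BMO}$ norm. $\mathrm{VMO}_c(\mathbf{R}^d)=\bigcup_n\mathrm{VMO}_{K_n}(\mathbf{R}^d)$, for a compact exhaustion $(K_n)$ of $\mathbf{R}^d$ with $K_n\subset\operatorname{Int}K_{n+1}$, carries the locally convex strict inductive limit topology; $\mathrm{L}^\infty\cap\mathrm{VMO}_c$ carries the topology induced from $\mathrm{VMO}_c$. Montel property: every closed and bounded subset is compact (for a Montel space one also requires barrelledness). *)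

theory Defs
  imports "HOL-Analysis.Analysis"
begin

section \<open>Measurable functions modulo equality almost everywhere\<close>

text \<open>
  The scalar field is a type \<open>'k\<close> of sort \<open>{real_normed_field, euclidean_space}\<close>. Up to
  isometric isomorphism the types of this sort are \<open>real\<close> and \<open>complex\<close>, so that both the real
  and the complex function spaces are covered.
\<close>

quotient_type (overloaded) ('a, 'k) aefun =
    "'a::euclidean_space \<Rightarrow> 'k::{real_normed_field, euclidean_space}" / partial:
    "\<lambda>f g. f \<in> borel_measurable lebesgue \<and> g \<in> borel_measurable lebesgue \<and>
           (AE x in lebesgue. f x = g x)"
proof (rule part_equivpI)
  show "\<exists>f::'a \<Rightarrow> 'k. f \<in> borel_measurable lebesgue \<and> f \<in> borel_measurable lebesgue \<and>
           (AE x in lebesgue. f x = f x)"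
    by (intro exI[of _ "\<lambda>_. 0"]) auto
  show "symp (\<lambda>f g::'a \<Rightarrow> 'k. f \<in> borel_measurable lebesgue \<and> g \<in> borel_measurable lebesgue \<and>
           (AE x in lebesgue. f x = g x))"
    by (auto simp: symp_def)
  show "transp (\<lambda>f g::'a \<Rightarrow> 'k. f \<in> borel_measurable lebesgue \<and> g \<in> borel_measurable lebesgue \<and>
           (AE x in lebesgue. f x = g x))"
    by (auto simp: transp_def elim: AE_mp)
qed

instantiation aefun :: (euclidean_space, "{real_normed_field, euclidean_space}") real_vector
begin

lift_definition zero_aefun :: "('a, 'b) aefun" is "\<lambda>_. 0"
  by simp

lift_definition plus_aefun :: "('a, 'b) aefun \<Rightarrow> ('a, 'b) aefun \<Rightarrow> ('a, 'b) aefun"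
  is "\<lambda>f g x. f x + g x"
  by auto

lift_definition minus_aefun :: "('a, 'b) aefun \<Rightarrow> ('a, 'b) aefun \<Rightarrow> ('a, 'b) aefun"
  is "\<lambda>f g x. f x - g x"
  by auto

lift_definition uminus_aefun :: "('a, 'b) aefun \<Rightarrow> ('a, 'b) aefun"
  is "\<lambda>f x. - f x"
  by auto

lift_definition scaleR_aefun :: "real \<Rightarrow> ('a, 'b) aefun \<Rightarrow> ('a, 'b) aefun"
  is "\<lambda>r f x. r *\<^sub>R f x"
  by auto

instance
  by standard (transfer; auto simp: algebra_simps)+

end

lift_definition scale_aefun ::
    "'k \<Rightarrow> ('a::euclidean_space, 'k::{real_normed_field, euclidean_space}) aefun \<Rightarrow> ('a, 'k) aefun"
  is "\<lambda>c f x. c * f x"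
  by auto

lift_definition locally_integrable ::
    "('a::euclidean_space, 'k::{real_normed_field, euclidean_space}) aefun \<Rightarrow> bool"
  is "\<lambda>f. \<forall>S. compact S \<longrightarrow> f absolutely_integrable_on S"
proof -
  fix f g :: "'a \<Rightarrow> 'k"
  assume A: "f \<in> borel_measurable lebesgue \<and> g \<in> borel_measurable lebesgue \<and>
    (AE x in lebesgue. f x = g x)"
  have "f absolutely_integrable_on S \<longleftrightarrow> g absolutely_integrable_on S" if "compact S" for S
  proof -
    have [measurable]: "S \<in> sets lebesgue" "f \<in> borel_measurable lebesgue"
        "g \<in> borel_measurable lebesgue"
      using that A by (auto simp: borel_compact)
    show ?thesis
      unfolding set_integrable_def by (rule integrable_cong_AE) (use A in auto)
  qed
  then show "(\<forall>S. compact S \<longrightarrow> f absolutely_integrable_on S) \<longleftrightarrow>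
      (\<forall>S. compact S \<longrightarrow> g absolutely_integrable_on S)"
    by blast
qed

lift_definition ess_bounded ::
    "('a::euclidean_space, 'k::{real_normed_field, euclidean_space}) aefun \<Rightarrow> bool"
  is "\<lambda>f. \<exists>C. AE x in lebesgue. norm (f x) \<le> C"
proof -
  fix f g :: "'a \<Rightarrow> 'k"
  assume A: "f \<in> borel_measurable lebesgue \<and> g \<in> borel_measurable lebesgue \<and>
    (AE x in lebesgue. f x = g x)"
  then have "(AE x in lebesgue. norm (f x) \<le> C) \<longleftrightarrow> (AE x in lebesgue. norm (g x) \<le> C)" for C
    by (intro iffI) (auto elim: eventually_elim2)
  then show "(\<exists>C. AE x in lebesgue. norm (f x) \<le> C) \<longleftrightarrow> (\<exists>C. AE x in lebesgue. norm (g x) \<le> C)"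
    by blast
qed

lift_definition ess_support ::
    "('a::euclidean_space, 'k::{real_normed_field, euclidean_space}) aefun \<Rightarrow> 'a set"
  is "\<lambda>f. - \<Union>{U. open U \<and> (AE x in lebesgue. x \<in> U \<longrightarrow> f x = 0)}"
proof -
  fix f g :: "'a \<Rightarrow> 'k"
  assume A: "f \<in> borel_measurable lebesgue \<and> g \<in> borel_measurable lebesgue \<and>
    (AE x in lebesgue. f x = g x)"
  then have "(AE x in lebesgue. x \<in> U \<longrightarrow> f x = 0) \<longleftrightarrow> (AE x in lebesgue. x \<in> U \<longrightarrow> g x = 0)" for U
    by (intro iffI) (auto elim: eventually_elim2)
  then show "- \<Union>{U. open U \<and> (AE x in lebesgue. x \<in> U \<longrightarrow> f x = 0)} =
      - \<Union>{U. open U \<and> (AE x in lebesgue. x \<in> U \<longrightarrow> g x = 0)}"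
    by simp
qed

definition ball_mean ::
    "('a::euclidean_space \<Rightarrow> 'k::{real_normed_field, euclidean_space}) \<Rightarrow> 'a \<Rightarrow> real \<Rightarrow> 'k"
  where "ball_mean f a r =
    (LINT x:ball a r|lebesgue. f x) /\<^sub>R measure lebesgue (ball a r)"

lift_definition mean_oscillation ::
    "('a::euclidean_space, 'k::{real_normed_field, euclidean_space}) aefun \<Rightarrow> 'a \<Rightarrow> real \<Rightarrow> real"
  is "\<lambda>f a r. (LINT x:ball a r|lebesgue. norm (f x - ball_mean f a r)) / measure lebesgue (ball a r)"
proof (intro ext)
  fix f g :: "'a \<Rightarrow> 'k" and a :: 'a and r :: real
  assume A: "f \<in> borel_measurable lebesgue \<and> g \<in> borel_measurable lebesgue \<and>
    (AE x in lebesgue. f x = g x)"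
  then have [measurable]: "f \<in> borel_measurable lebesgue" "g \<in> borel_measurable lebesgue"
    and ae: "AE x in lebesgue. f x = g x"
    by auto
  have [measurable]: "ball a r \<in> sets lebesgue"
    by simp
  have mean: "ball_mean f a r = ball_mean g a r"
    unfolding ball_mean_def set_lebesgue_integral_def
    by (intro arg_cong2[where f = "(*\<^sub>R)"] refl integral_cong_AE, measurable) (use ae in auto)
  show "(LINT x:ball a r|lebesgue. norm (f x - ball_mean f a r)) / measure lebesgue (ball a r) =
      (LINT x:ball a r|lebesgue. norm (g x - ball_mean g a r)) / measure lebesgue (ball a r)"
    unfolding mean set_lebesgue_integral_def
    by (intro arg_cong2[where f = "(/)"] refl integral_cong_AE, measurable) (use ae in auto)
qed


section \<open>The spaces \<open>BMO\<close>, \<open>VMO\<close>, \<open>VMO\<^sub>K\<close> and \<open>L\<^sup>\<infinity>\<close>\<close>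

definition bmo_seminorm ::
    "('a::euclidean_space, 'k::{real_normed_field, euclidean_space}) aefun \<Rightarrow> ennreal"
  where "bmo_seminorm f = (SUP a. SUP r\<in>{0<..}. ennreal (mean_oscillation f a r))"

definition BMO :: "('a::euclidean_space, 'k::{real_normed_field, euclidean_space}) aefun set"
  where "BMO = {f. locally_integrable f \<and> bmo_seminorm f < \<infinity>}"

definition Cc :: "('a::euclidean_space, 'k::{real_normed_field, euclidean_space}) aefun set"
  where "Cc = abs_aefun ` {g. continuous_on UNIV g \<and> compact (closure {x. g x \<noteq> 0})}"

definition VMO :: "('a::euclidean_space, 'k::{real_normed_field, euclidean_space}) aefun set"
  where "VMO = {f \<in> BMO. \<forall>\<epsilon>>0. \<exists>g\<in>Cc. bmo_seminorm (f - g) < \<epsilon>}"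

definition VMO_on ::
    "'a set \<Rightarrow> ('a::euclidean_space, 'k::{real_normed_field, euclidean_space}) aefun set"
  where "VMO_on K = {f \<in> VMO. ess_support f \<subseteq> K}"

definition bmo_dist ::
    "('a::euclidean_space, 'k::{real_normed_field, euclidean_space}) aefun \<Rightarrow> ('a, 'k) aefun \<Rightarrow> real"
  where "bmo_dist f g = enn2real (bmo_seminorm (f - g))"

definition VMO_on_topology ::
    "'a set \<Rightarrow> ('a::euclidean_space, 'k::{real_normed_field, euclidean_space}) aefun topology"
  where "VMO_on_topology K = Metric_space.mtopology (VMO_on K) bmo_dist"

definition Linf :: "('a::euclidean_space, 'k::{real_normed_field, euclidean_space}) aefun set"
  where "Linf = {f. ess_bounded f}"


lemma mean_oscillation_nonneg: "0 \<le> mean_oscillation f a r"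
  by (transfer, unfold set_lebesgue_integral_def)
     (intro divide_nonneg_nonneg integral_nonneg; simp)

lemma mean_oscillation_minus_commute: "mean_oscillation (f - g) a r = mean_oscillation (g - f) a r"
proof (transfer fixing: a r)
  fix f g :: "'a \<Rightarrow> 'b"
  have 1: "ball_mean (\<lambda>x. f x - g x) a r = - ball_mean (\<lambda>x. g x - f x) a r"
    unfolding ball_mean_def set_lebesgue_integral_def
    by (simp flip: scaleR_minus_right integral_minus)
  have "norm (f x - g x - ball_mean (\<lambda>x. f x - g x) a r) =
        norm (g x - f x - ball_mean (\<lambda>x. g x - f x) a r)" for x
    unfolding 1 by (subst norm_minus_cancel[symmetric]) (simp add: algebra_simps)
  then show "(LINT x:ball a r|lebesgue. norm (f x - g x - ball_mean (\<lambda>x. f x - g x) a r)) /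
        measure lebesgue (ball a r) =
      (LINT x:ball a r|lebesgue. norm (g x - f x - ball_mean (\<lambda>x. g x - f x) a r)) /
        measure lebesgue (ball a r)"
    by presburger
qed

lemma absolutely_integrable_on_ball:
  assumes "\<forall>S. compact S \<longrightarrow> f absolutely_integrable_on S"
  shows "f absolutely_integrable_on ball a r"
  by (rule set_integrable_subset[of _ "cball a r"]) (use assms in auto)

lemma absolutely_integrable_on_ball_diff_const:
  assumes "f absolutely_integrable_on ball a r"
  shows "(\<lambda>x. f x - c) absolutely_integrable_on ball a r"
proof -
  have "(\<lambda>x. c) absolutely_integrable_on ball a r"
    unfolding set_integrable_def using emeasure_lborel_ball_finite[of a r]
    by (intro integrable_real_indicator[THEN integrable_scaleR_left]) auto
  then show ?thesis
    using assms by (intro set_integral_diff(1))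
qed

lemma mean_oscillation_add:
  assumes "locally_integrable f" "locally_integrable g"
  shows "mean_oscillation (f + g) a r \<le> mean_oscillation f a r + mean_oscillation g a r"
  using assms
proof (transfer fixing: a r)
  fix f g :: "'a \<Rightarrow> 'b"
  assume "\<forall>S. compact S \<longrightarrow> f absolutely_integrable_on S"
    and "\<forall>S. compact S \<longrightarrow> g absolutely_integrable_on S"
  then have f: "f absolutely_integrable_on ball a r" and g: "g absolutely_integrable_on ball a r"
    by (simp_all add: absolutely_integrable_on_ball)
  have mean: "ball_mean (\<lambda>x. f x + g x) a r = ball_mean f a r + ball_mean g a r"
    unfolding ball_mean_def set_integral_add(2)[OF f g] by (simp add: scaleR_add_right)
  let ?F = "\<lambda>x. f x - ball_mean f a r" and ?G = "\<lambda>x. g x - ball_mean g a r"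
  have F: "?F absolutely_integrable_on ball a r" and G: "?G absolutely_integrable_on ball a r"
    using f g by (auto intro: absolutely_integrable_on_ball_diff_const)
  have "(LINT x:ball a r|lebesgue. norm (?F x + ?G x)) \<le>
      (LINT x:ball a r|lebesgue. norm (?F x) + norm (?G x))"
    by (intro set_integral_mono set_integrable_norm set_integral_add(1) F G norm_triangle_ineq)
  also have "\<dots> = (LINT x:ball a r|lebesgue. norm (?F x)) + (LINT x:ball a r|lebesgue. norm (?G x))"
    by (intro set_integral_add(2) set_integrable_norm F G)
  finally show "(LINT x:ball a r|lebesgue. norm (f x + g x - ball_mean (\<lambda>x. f x + g x) a r)) /
        measure lebesgue (ball a r) \<le>
      (LINT x:ball a r|lebesgue. norm (f x - ball_mean f a r)) / measure lebesgue (ball a r) +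
      (LINT x:ball a r|lebesgue. norm (g x - ball_mean g a r)) / measure lebesgue (ball a r)"
    unfolding mean by (simp add: divide_right_mono flip: add_divide_distrib) (simp add: algebra_simps divide_right_mono)
qed

lemma locally_integrable_add:
  "locally_integrable f \<Longrightarrow> locally_integrable g \<Longrightarrow> locally_integrable (f + g)"
  by transfer (auto intro: set_integral_add(1))

lemma locally_integrable_diff:
  "locally_integrable f \<Longrightarrow> locally_integrable g \<Longrightarrow> locally_integrable (f - g)"
  by transfer (auto intro: set_integral_diff(1))

lemma bmo_seminorm_add:
  assumes "locally_integrable f" "locally_integrable g"
  shows "bmo_seminorm (f + g) \<le> bmo_seminorm f + bmo_seminorm g"
  unfolding bmo_seminorm_def
proof (intro SUP_least)
  fix a :: 'a and r :: real
  assume r: "r \<in> {0<..}"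
  have *: "ennreal (mean_oscillation h a r) \<le> (SUP a. SUP r\<in>{0<..}. ennreal (mean_oscillation h a r))"
    for h :: "('a, 'b) aefun"
    using r by (intro SUP_upper2[of a] SUP_upper2[of r]) auto
  have "ennreal (mean_oscillation (f + g) a r) \<le>
      ennreal (mean_oscillation f a r) + ennreal (mean_oscillation g a r)"
    using mean_oscillation_add[OF assms, of a r]
    by (simp add: mean_oscillation_nonneg ennreal_leI flip: ennreal_plus)
  also have "\<dots> \<le> (SUP a. SUP r\<in>{0<..}. ennreal (mean_oscillation f a r)) +
      (SUP a. SUP r\<in>{0<..}. ennreal (mean_oscillation g a r))"
    by (intro add_mono *)
  finally show "ennreal (mean_oscillation (f + g) a r) \<le> \<dots>" .
qed

lemma bmo_seminorm_minus_commute: "bmo_seminorm (f - g) = bmo_seminorm (g - f)"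
  unfolding bmo_seminorm_def by (subst mean_oscillation_minus_commute) (rule refl)

lemma bmo_seminorm_diff_finite:
  assumes "f \<in> BMO" "g \<in> BMO"
  shows "bmo_seminorm (f - g) < \<infinity>"
proof -
  have zero: "locally_integrable (0 :: ('a, 'b) aefun)"
    by transfer auto
  have "bmo_seminorm (0 - g) = bmo_seminorm g"
    by (metis bmo_seminorm_minus_commute diff_zero)
  then have "bmo_seminorm (f + (0 - g)) \<le> bmo_seminorm f + bmo_seminorm g"
    using bmo_seminorm_add[of f "0 - g"] assms locally_integrable_diff[OF zero, of g]
    by (simp add: BMO_def)
  then show ?thesis
    using assms by (auto simp: BMO_def elim!: order_le_less_trans)
qed

lemma AE_ess_support: "AE x in lebesgue. x \<notin> ess_support f \<longrightarrow> rep_aefun f x = 0"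
proof -
  define \<U> where "\<U> = {U. open U \<and> (AE x in lebesgue. x \<in> U \<longrightarrow> rep_aefun f x = 0)}"
  obtain \<V> where \<V>: "\<V> \<subseteq> \<U>" "countable \<V>" "\<Union>\<V> = \<Union>\<U>"
    using Lindelof[of \<U>] unfolding \<U>_def by blast
  have "AE x in lebesgue. \<forall>U\<in>\<V>. x \<in> U \<longrightarrow> rep_aefun f x = 0"
    using \<V> by (intro AE_ball_countable[THEN iffD2]) (auto simp: \<U>_def)
  moreover have "ess_support f = - \<Union>\<V>"
    unfolding ess_support.rep_eq \<V>(3) \<U>_def ..
  ultimately show ?thesis
    by auto
qed

lemma rep_aefun_measurable: "rep_aefun f \<in> borel_measurable lebesgue"
  using Quotient_rep_reflp[OF Quotient_aefun] by auto

lemma aefun_eqI: "AE x in lebesgue. rep_aefun f x = rep_aefun g x \<Longrightarrow> f = g"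
  using Quotient_rel_rep[OF Quotient_aefun, of f g] by (simp add: rep_aefun_measurable)

lemma AE_rep_diff: "AE x in lebesgue. rep_aefun (f - g) x = rep_aefun f x - rep_aefun g x"
  using Quotient_rep_abs[OF Quotient_aefun, of "\<lambda>x. rep_aefun f x - rep_aefun g x"]
    borel_measurable_diff[OF rep_aefun_measurable[of f] rep_aefun_measurable[of g]]
  by (simp add: minus_aefun_def)

lemma AE_rep_zero: "AE x in lebesgue. rep_aefun 0 x = 0"
  using Quotient_rep_abs[OF Quotient_aefun, of "\<lambda>x. 0"] unfolding zero_aefun_def by auto

lemma bmo_seminorm_eq_0_imp_eq_0:
  fixes h :: "('a::euclidean_space, 'k::{real_normed_field, euclidean_space}) aefun"
  assumes "locally_integrable h" "bmo_seminorm h = 0"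
    and "AE x in lebesgue. x \<notin> cball 0 R \<longrightarrow> rep_aefun h x = 0" "R > 0"
  shows "h = 0"
proof -
  define c where "c = ball_mean (rep_aefun h) 0 (3 * R)"
  let ?B = "ball (0::'a) (3 * R)"
  have int: "(\<lambda>x. rep_aefun h x - c) absolutely_integrable_on ?B"
    using assms(1) unfolding locally_integrable.rep_eq
    by (intro absolutely_integrable_on_ball_diff_const absolutely_integrable_on_ball)
  have "ennreal (mean_oscillation h 0 (3 * R)) \<le> bmo_seminorm h"
    unfolding bmo_seminorm_def
    by (intro SUP_upper2[of 0] SUP_upper2[of "3 * R"]) (use assms in auto)
  then have "mean_oscillation h 0 (3 * R) = 0"
    using assms(2) mean_oscillation_nonneg[of h 0 "3 * R"] by simp
  moreover have "measure lebesgue ?B > 0"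
    using content_ball_pos[of "3 * R" "0::'a"] assms(4) by simp
  ultimately have "(LINT x:?B|lebesgue. norm (rep_aefun h x - c)) = 0"
    unfolding mean_oscillation.rep_eq c_def by auto
  moreover have "integrable lebesgue (\<lambda>x. indicat_real ?B x *\<^sub>R norm (rep_aefun h x - c))"
    using set_integrable_norm[OF int] by (simp add: set_integrable_def)
  ultimately have "AE x in lebesgue. indicat_real ?B x *\<^sub>R norm (rep_aefun h x - c) = 0"
    unfolding set_lebesgue_integral_def by (subst (asm) integral_nonneg_eq_0_iff_AE) auto
  then have eq_c: "AE x in lebesgue. x \<in> ?B \<longrightarrow> rep_aefun h x = c"
    by (rule AE_mp) (auto simp: indicator_def)
  have "c = 0"
  proof (rule ccontr)
    assume "c \<noteq> 0"
    obtain b :: 'a where b: "b \<in> Basis"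
      using nonempty_Basis by blast
    have sub: "x \<in> ?B \<and> x \<notin> cball 0 R" if "x \<in> ball ((2 * R) *\<^sub>R b) R" for x
    proof -
      have "norm ((2 * R) *\<^sub>R b) = 2 * R"
        using b assms(4) by simp
      moreover have "norm ((2 * R) *\<^sub>R b - x) < R"
        using that by (simp add: dist_norm)
      ultimately show ?thesis
        using norm_triangle_ineq2[of "(2 * R) *\<^sub>R b" x] norm_triangle_ineq2[of x "(2 * R) *\<^sub>R b"]
        by (auto simp: norm_minus_commute)
    qed
    have "AE x in lebesgue. x \<notin> ball ((2 * R) *\<^sub>R b) R"
      using eq_c assms(3) by eventually_elim (use sub \<open>c \<noteq> 0\<close> in metis)
    then have "ball ((2 * R) *\<^sub>R b) R \<in> null_sets lebesgue"
      by (subst AE_iff_null_sets) auto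
    then have "measure lebesgue (ball ((2 * R) *\<^sub>R b) R) = 0"
      by (rule measure_eq_0_null_sets)
    then show False
      using content_ball_pos[of R "(2 * R) *\<^sub>R b"] assms(4) by simp
  qed
  have "AE x in lebesgue. rep_aefun h x = rep_aefun 0 x"
    using eq_c assms(3) AE_rep_zero unfolding \<open>c = 0\<close>
    by eventually_elim (use assms(4) in auto)
  then show ?thesis
    by (rule aefun_eqI)
qed

text \<open>
  The seminorm vanishes on constants, but a constant supported in a compact set is zero, so that it
  is a norm on \<open>VMO\<^sub>K\<close>.
\<close>

lemma Metric_space_VMO_on:
  fixes K :: "'a::euclidean_space set"
  assumes "compact K"
  shows "Metric_space (VMO_on K :: ('a, 'k::{real_normed_field, euclidean_space}) aefun set) bmo_dist"
proof
  fix f g h :: "('a, 'k) aefun"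
  show "0 \<le> bmo_dist f g"
    by (simp add: bmo_dist_def)
  show "bmo_dist f g = bmo_dist g f"
    by (simp add: bmo_dist_def bmo_seminorm_minus_commute)
  assume f: "f \<in> VMO_on K" and g: "g \<in> VMO_on K"
  then have li: "locally_integrable f" "locally_integrable g" and B: "f \<in> BMO" "g \<in> BMO"
    by (auto simp: VMO_on_def VMO_def BMO_def)
  show "bmo_dist f g = 0 \<longleftrightarrow> f = g"
  proof
    assume "bmo_dist f g = 0"
    then have 0: "bmo_seminorm (f - g) = 0"
      using bmo_seminorm_diff_finite[OF B] by (auto simp add: bmo_dist_def enn2real_eq_0_iff)
    obtain R where R: "R > 0" "K \<subseteq> cball 0 R"
      using compact_imp_bounded[OF assms] by (auto simp: bounded_pos subset_iff)
    have "AE x in lebesgue. x \<notin> cball 0 R \<longrightarrow> rep_aefun (f - g) x = 0"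
      using AE_ess_support[of f] AE_ess_support[of g] AE_rep_diff[of f g]
      by eventually_elim (use R f g in \<open>auto simp: VMO_on_def\<close>)
    then have "f - g = 0"
      by (rule bmo_seminorm_eq_0_imp_eq_0[OF locally_integrable_diff[OF li] 0 _ R(1)])
    then show "f = g"
      by simp
  next
    assume "f = g"
    moreover have "bmo_seminorm (0 :: ('a, 'k) aefun) = 0"
    proof -
      have "mean_oscillation (0 :: ('a, 'k) aefun) a r = 0" for a r
        by transfer (simp add: ball_mean_def)
      then show ?thesis
        by (simp add: bmo_seminorm_def)
    qed
    ultimately show "bmo_dist f g = 0"
      by (simp add: bmo_dist_def)
  qed
  assume h: "h \<in> VMO_on K"
  then have li': "locally_integrable h" and B': "h \<in> BMO"
    by (auto simp: VMO_on_def VMO_def BMO_def)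
  have "bmo_seminorm (f - h) \<le> bmo_seminorm (f - g) + bmo_seminorm (g - h)"
    using bmo_seminorm_add[of "f - g" "g - h"] locally_integrable_diff li li' by fastforce
  then show "bmo_dist f h \<le> bmo_dist f g + bmo_dist g h"
    unfolding bmo_dist_def
    using bmo_seminorm_diff_finite B B'
    by (subst enn2real_plus[symmetric]) (auto intro!: enn2real_mono)
qed


section \<open>Locally convex spaces\<close>

text \<open>
  A topological vector space is given by a topology whose carrier is a linear subspace of an
  ambient type, together with the multiplication by scalars. The following notions are meant to be
  applied to Hausdorff locally convex spaces only, so that these properties are not repeated in the
  definition of a Montel space.
\<close>

definition zero_nhd :: "'v::real_vector topology \<Rightarrow> 'v set \<Rightarrow> bool"
  where "zero_nhd X U \<longleftrightarrow> U \<subseteq> topspace X \<and> (\<exists>W. openin X W \<and> 0 \<in> W \<and> W \<subseteq> U)"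

definition balanced :: "('k::real_normed_field \<Rightarrow> 'v \<Rightarrow> 'v) \<Rightarrow> 'v set \<Rightarrow> bool"
  where "balanced smul U \<longleftrightarrow> (\<forall>c. norm c \<le> 1 \<longrightarrow> smul c ` U \<subseteq> U)"

definition absorbs :: "('k::real_normed_field \<Rightarrow> 'v \<Rightarrow> 'v) \<Rightarrow> 'v set \<Rightarrow> 'v set \<Rightarrow> bool"
  where "absorbs smul U B \<longleftrightarrow> (\<exists>r>0. \<forall>c. norm c \<ge> r \<longrightarrow> B \<subseteq> smul c ` U)"

definition tvs_bounded ::
    "('k::real_normed_field \<Rightarrow> 'v::real_vector \<Rightarrow> 'v) \<Rightarrow> 'v topology \<Rightarrow> 'v set \<Rightarrow> bool"
  where "tvs_bounded smul X B \<longleftrightarrow>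
    B \<subseteq> topspace X \<and> (\<forall>U. zero_nhd X U \<longrightarrow> absorbs smul U B)"

definition barrel ::
    "('k::real_normed_field \<Rightarrow> 'v::real_vector \<Rightarrow> 'v) \<Rightarrow> 'v topology \<Rightarrow> 'v set \<Rightarrow> bool"
  where "barrel smul X T \<longleftrightarrow> closedin X T \<and> convex T \<and> balanced smul T \<and>
    (\<forall>x\<in>topspace X. absorbs smul T {x})"

definition barrelled ::
    "('k::real_normed_field \<Rightarrow> 'v::real_vector \<Rightarrow> 'v) \<Rightarrow> 'v topology \<Rightarrow> bool"
  where "barrelled smul X \<longleftrightarrow> (\<forall>T. barrel smul X T \<longrightarrow> zero_nhd X T)"

definition Montel_property ::
    "('k::real_normed_field \<Rightarrow> 'v::real_vector \<Rightarrow> 'v) \<Rightarrow> 'v topology \<Rightarrow> bool"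
  where "Montel_property smul X \<longleftrightarrow>
    (\<forall>B. closedin X B \<and> tvs_bounded smul X B \<longrightarrow> compactin X B)"

definition Montel_space ::
    "('k::real_normed_field \<Rightarrow> 'v::real_vector \<Rightarrow> 'v) \<Rightarrow> 'v topology \<Rightarrow> bool"
  where "Montel_space smul X \<longleftrightarrow> barrelled smul X \<and> Montel_property smul X"

text \<open>
  The locally convex inductive limit of an increasing sequence of locally convex spaces \<open>E n\<close>: a
  base of neighbourhoods of zero consists of the absolutely convex sets \<open>U\<close> such that
  \<open>U \<inter> topspace (E n)\<close> is a neighbourhood of zero in \<open>E n\<close> for all \<open>n\<close>.
\<close>

definition lc_limit_base ::
    "('k::real_normed_field \<Rightarrow> 'v::real_vector \<Rightarrow> 'v) \<Rightarrow> (nat \<Rightarrow> 'v topology) \<Rightarrow> 'v set set"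
  where "lc_limit_base smul E =
    {U. U \<subseteq> (\<Union>n. topspace (E n)) \<and> convex U \<and> balanced smul U \<and>
        (\<forall>n. zero_nhd (E n) (U \<inter> topspace (E n)))}"

definition lc_inductive_limit ::
    "('k::real_normed_field \<Rightarrow> 'v::real_vector \<Rightarrow> 'v) \<Rightarrow> (nat \<Rightarrow> 'v topology) \<Rightarrow> 'v topology"
  where "lc_inductive_limit smul E =
    topology (\<lambda>S. S \<subseteq> (\<Union>n. topspace (E n)) \<and>
      (\<forall>x\<in>S. \<exists>U\<in>lc_limit_base smul E. (+) x ` U \<subseteq> S))"

lemma openin_lc_inductive_limit:
  "openin (lc_inductive_limit smul E) S \<longleftrightarrow> S \<subseteq> (\<Union>n. topspace (E n)) \<and>
    (\<forall>x\<in>S. \<exists>U\<in>lc_limit_base smul E. (+) x ` U \<subseteq> S)"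
proof -
  have base_Int: "U \<inter> V \<in> lc_limit_base smul E"
    if U: "U \<in> lc_limit_base smul E" and V: "V \<in> lc_limit_base smul E" for U V
  proof -
    have "zero_nhd (E n) (U \<inter> V \<inter> topspace (E n))" for n
    proof -
      obtain A B where "openin (E n) A" "0 \<in> A" "A \<subseteq> U \<inter> topspace (E n)"
        and "openin (E n) B" "0 \<in> B" "B \<subseteq> V \<inter> topspace (E n)"
        using U V unfolding lc_limit_base_def zero_nhd_def by blast
      then show ?thesis
        unfolding zero_nhd_def by (intro conjI exI[of _ "A \<inter> B"]) auto
    qed
    moreover have "balanced smul (U \<inter> V)"
      using U V unfolding lc_limit_base_def balanced_def by blast
    ultimately show ?thesis
      using U V unfolding lc_limit_base_def by (auto intro: convex_Int)
  qed
  have "istopology (\<lambda>S. S \<subseteq> (\<Union>n. topspace (E n)) \<and>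
      (\<forall>x\<in>S. \<exists>U\<in>lc_limit_base smul E. (+) x ` U \<subseteq> S))"
    unfolding istopology_def
  proof (intro conjI allI impI ballI)
    fix S T x
    assume S: "S \<subseteq> (\<Union>n. topspace (E n)) \<and> (\<forall>x\<in>S. \<exists>U\<in>lc_limit_base smul E. (+) x ` U \<subseteq> S)"
      and T: "T \<subseteq> (\<Union>n. topspace (E n)) \<and> (\<forall>x\<in>T. \<exists>U\<in>lc_limit_base smul E. (+) x ` U \<subseteq> T)"
      and x: "x \<in> S \<inter> T"
    obtain U V where "U \<in> lc_limit_base smul E" "(+) x ` U \<subseteq> S"
      and "V \<in> lc_limit_base smul E" "(+) x ` V \<subseteq> T"
      using S T x by blast
    then show "\<exists>U\<in>lc_limit_base smul E. (+) x ` U \<subseteq> S \<inter> T"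
      by (intro bexI[of _ "U \<inter> V"] base_Int) auto
  next
    fix \<K> x
    assume \<K>: "\<forall>S\<in>\<K>. S \<subseteq> (\<Union>n. topspace (E n)) \<and>
        (\<forall>x\<in>S. \<exists>U\<in>lc_limit_base smul E. (+) x ` U \<subseteq> S)"
      and "x \<in> \<Union>\<K>"
    then show "\<exists>U\<in>lc_limit_base smul E. (+) x ` U \<subseteq> \<Union>\<K>"
      by (meson Union_iff Union_upper subset_trans)
  qed blast+
  then show ?thesis
    by (simp add: lc_inductive_limit_def)
qed


section \<open>The strict LF-space \<open>VMO\<^sub>c\<close>\<close>

definition compact_exhaustion :: "(nat \<Rightarrow> 'a::topological_space set) \<Rightarrow> bool"
  where "compact_exhaustion K \<longleftrightarrow> (\<forall>n. compact (K n)) \<and>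
    (\<forall>n. K n \<subseteq> interior (K (Suc n))) \<and> (\<Union>n. K n) = UNIV"

definition VMOc_topology ::
    "(nat \<Rightarrow> 'a set) \<Rightarrow> ('a::euclidean_space, 'k::{real_normed_field, euclidean_space}) aefun topology"
  where "VMOc_topology K = lc_inductive_limit scale_aefun (\<lambda>n. VMO_on_topology (K n))"

end

theory Submission
  imports Defs
begin

text \<open>
  Dilating a continuous bump by powers of \<open>4\<close> gives essentially bounded functions with supports in
  one compact set, which are bounded in the BMO norm but uniformly separated in it, because the BMO
  norm is invariant under dilations. The BMO norm is continuous on the inductive limit (strictness
  is not needed for this), so that the set of these functions is closed and discrete there, hence
  not compact, while it is bounded since it is bounded in a single step of the limit.
\<close>

section \<open>Scalar multiplication and the BMO seminorm\<close>

text \<open>Dilation enters through two estimates uniform in the scale. All bumps take values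
  between 0 and 1, which bounds every BMO norm by 2. For separation a single ball is enough: once
  two radii differ by a factor of at least 4, testing the difference on a ball of 4 times the
  smaller radius leaves the gap \<open>(1 / 4) ^ DIM('a)\<close>, a ratio of volumes. The obstacle
  is that the limit topology is defined by absolutely convex sets and not by a metric. Two one-sided
  facts replace a metric: BMO balls are open in the limit, which yields closedness and
  non-compactness, and every neighbourhood of zero contains a small BMO ball of each step, which
  yields boundedness.\<close>

lemma scaleR_aefun_eq: "r *\<^sub>R f = scale_aefun (of_real r) f"
  by transfer (auto simp: scaleR_conv_of_real)

lemma scale_aefun_zero_left: "scale_aefun 0 f = 0"
  by transfer auto

lemma locally_integrable_scale: "locally_integrable f \<Longrightarrow> locally_integrable (scale_aefun c f)"
  by transfer (auto intro: set_integrable_mult_right)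

lemma ball_mean_mult: "ball_mean (\<lambda>x. c * f x) a r = c * ball_mean f a r"
  by (simp add: ball_mean_def)

lemma mean_oscillation_scale:
  "mean_oscillation (scale_aefun c f) a r = norm c * mean_oscillation f a r"
  by (transfer fixing: a r)
    (simp add: ball_mean_mult norm_mult flip: right_diff_distrib)

lemma bmo_seminorm_scale: "bmo_seminorm (scale_aefun c f) = ennreal (norm c) * bmo_seminorm f"
  by (simp add: bmo_seminorm_def mean_oscillation_scale ennreal_mult mean_oscillation_nonneg
      SUP_mult_left_ennreal)

lemma bmo_seminorm_zero: "bmo_seminorm 0 = 0"
  using bmo_seminorm_scale[of 0 0] by (simp add: scale_aefun_zero_left)

section \<open>Linear structure of VMO\<close>

lemma BMO_add: "f \<in> BMO \<Longrightarrow> g \<in> BMO \<Longrightarrow> f + g \<in> BMO"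
  using bmo_seminorm_add[of f g]
  by (auto simp: BMO_def locally_integrable_add elim!: order_le_less_trans)

lemma BMO_scale: "f \<in> BMO \<Longrightarrow> scale_aefun c f \<in> BMO"
  by (auto simp: BMO_def locally_integrable_scale bmo_seminorm_scale ennreal_mult_less_top)

section \<open>Classes of continuous functions with compact support\<close>

lemma continuous_imp_borel_measurable_lebesgue:
  "continuous_on UNIV g \<Longrightarrow> g \<in> borel_measurable lebesgue"
  by (simp add: borel_measurable_continuous_onI measurable_completion)

lemma rep_abs_aefun:
  "g \<in> borel_measurable lebesgue \<Longrightarrow> AE x in lebesgue. rep_aefun (abs_aefun g) x = g x"
  using Quotient_rep_abs[OF Quotient_aefun, of g] by simp

lemma scale_aefun_abs:
  "g \<in> borel_measurable lebesgue \<Longrightarrow> scale_aefun c (abs_aefun g) = abs_aefun (\<lambda>x. c * g x)"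
  by (rule scale_aefun.abs_eq) simp

lemma plus_aefun_abs:
  "f \<in> borel_measurable lebesgue \<Longrightarrow> g \<in> borel_measurable lebesgue \<Longrightarrow>
    abs_aefun f + abs_aefun g = abs_aefun (\<lambda>x. f x + g x)"
  by (rule plus_aefun.abs_eq) simp_all

lemma minus_aefun_abs:
  "f \<in> borel_measurable lebesgue \<Longrightarrow> g \<in> borel_measurable lebesgue \<Longrightarrow>
    abs_aefun f - abs_aefun g = abs_aefun (\<lambda>x. f x - g x)"
  by (rule minus_aefun.abs_eq) simp_all

lemma compact_closure_subset:
  fixes S :: "'a::t2_space set"
  shows "compact (closure T) \<Longrightarrow> S \<subseteq> T \<Longrightarrow> compact (closure S)"
  using compact_Int_closed[of "closure T" "closure S"] closure_mono[of S T]
  by (simp add: inf.absorb2)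

lemma Cc_scale:
  fixes f :: "('a::euclidean_space, 'k::{real_normed_field, euclidean_space}) aefun"
  assumes "f \<in> Cc" shows "scale_aefun c f \<in> Cc"
proof -
  obtain g where g: "continuous_on UNIV g" "compact (closure {x. g x \<noteq> 0})" "f = abs_aefun g"
    using assms by (auto simp: Cc_def)
  have "scale_aefun c f = abs_aefun (\<lambda>x. c * g x)"
    using g by (simp add: scale_aefun_abs continuous_imp_borel_measurable_lebesgue)
  moreover have "continuous_on UNIV (\<lambda>x. c * g x)"
    using g by (intro continuous_intros)
  moreover have "compact (closure {x. c * g x \<noteq> 0})"
    using g(2) by (rule compact_closure_subset) auto
  ultimately show ?thesis
    by (auto simp: Cc_def)
qed

lemma Cc_add:
  fixes f g :: "('a::euclidean_space, 'k::{real_normed_field, euclidean_space}) aefun"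
  assumes "f \<in> Cc" "g \<in> Cc" shows "f + g \<in> Cc"
proof -
  obtain u where u: "continuous_on UNIV u" "compact (closure {x. u x \<noteq> 0})" "f = abs_aefun u"
    using assms by (auto simp: Cc_def)
  obtain v where v: "continuous_on UNIV v" "compact (closure {x. v x \<noteq> 0})" "g = abs_aefun v"
    using assms by (auto simp: Cc_def)
  have "f + g = abs_aefun (\<lambda>x. u x + v x)"
    using u v by (simp add: plus_aefun_abs continuous_imp_borel_measurable_lebesgue)
  moreover have "continuous_on UNIV (\<lambda>x. u x + v x)"
    using u v by (intro continuous_intros)
  moreover have "compact (closure {x. u x + v x \<noteq> 0})"
    by (rule compact_closure_subset[of "{x. u x \<noteq> 0} \<union> {x. v x \<noteq> 0}"])
      (use u v in \<open>auto simp: closure_Un compact_Un\<close>)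
  ultimately show ?thesis
    by (auto simp: Cc_def)
qed

lemma scale_aefun_diff: "scale_aefun c f - scale_aefun c g = scale_aefun c (f - g)"
  by transfer (auto simp: algebra_simps)

lemma locally_integrable_zero: "locally_integrable 0"
  by transfer auto

lemma locally_integrable_continuous:
  assumes "continuous_on UNIV g"
  shows "locally_integrable (abs_aefun g)"
proof -
  have "g absolutely_integrable_on S" if "compact S" for S
    using borel_integrable_compact[OF that, of g] continuous_on_subset[OF assms]
    by (simp add: set_integrable_def integrable_completion borel_measurable_integrable)
  then show ?thesis
    using assms by (simp add: locally_integrable.abs_eq continuous_imp_borel_measurable_lebesgue)
qed

text \<open>On any ball the mean is bounded by \<open>M\<close> as well, so the integrand of the
  oscillation is at most \<open>2 * M\<close>. The bound ignores the radius, which makes it uniform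
  over all dilates of one function.\<close>

lemma bounded_continuous_BMO:
  fixes g :: "'a::euclidean_space \<Rightarrow> 'k::{real_normed_field, euclidean_space}"
  assumes cont: "continuous_on UNIV g" and bound: "\<And>x. norm (g x) \<le> M"
  shows "abs_aefun g \<in> BMO" "bmo_seminorm (abs_aefun g) \<le> ennreal (2 * M)"
proof -
  have meas[measurable]: "g \<in> borel_measurable lebesgue"
    using cont by (rule continuous_imp_borel_measurable_lebesgue)
  have li: "locally_integrable (abs_aefun g)"
    using cont by (rule locally_integrable_continuous)
  have M: "0 \<le> M"
    using bound[of 0] norm_ge_zero order_trans by blast
  have "mean_oscillation (abs_aefun g) a r \<le> 2 * M" if r: "r > 0" for a r
  proof -
    let ?B = "ball a r"
    let ?m = "measure lebesgue ?B"
    have m: "?m > 0"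
      using content_ball_pos[OF r, of a] by simp
    have gB: "g absolutely_integrable_on ?B"
      using li by (simp add: locally_integrable.abs_eq absolutely_integrable_on_ball)
    \<comment> \<open>The constant is written as the zero function minus \<open>-c\<close>.\<close>
    have cB: "(\<lambda>x. c) absolutely_integrable_on ?B" for c :: real
      using absolutely_integrable_on_ball_diff_const[of a r "\<lambda>_. 0::real" "-c"]
      by (simp add: set_integrable_def)
    have intc: "(LINT x:?B|lebesgue. c) = c * ?m" for c :: real
      by (simp add: set_lebesgue_integral_def)
    have "norm (LINT x:?B|lebesgue. g x) \<le> (LINT x:?B|lebesgue. norm (g x))"
      using gB by (rule set_integral_norm_bound)
    also have "\<dots> \<le> (LINT x:?B|lebesgue. M)"
      by (intro set_integral_mono set_integrable_norm gB cB bound)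
    finally have mean: "norm (ball_mean g a r) \<le> M"
      using m by (simp add: ball_mean_def intc divide_simps mult_ac)
    have "(LINT x:?B|lebesgue. norm (g x - ball_mean g a r)) \<le> (LINT x:?B|lebesgue. 2 * M)"
    proof (intro set_integral_mono set_integrable_norm cB absolutely_integrable_on_ball_diff_const gB)
      show "norm (g x - ball_mean g a r) \<le> 2 * M" for x
        using norm_triangle_ineq4[of "g x" "ball_mean g a r"] bound[of x] mean by linarith
    qed
    then show ?thesis
      using m by (simp add: mean_oscillation.abs_eq intc pos_divide_le_eq mult_ac)
  qed
  then show le: "bmo_seminorm (abs_aefun g) \<le> ennreal (2 * M)"
    unfolding bmo_seminorm_def by (intro SUP_least ennreal_leI) auto
  show "abs_aefun g \<in> BMO"
    using li order_le_less_trans[OF le, of \<infinity>] by (simp add: BMO_def)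
qed

lemma VMO_scale:
  fixes f :: "('a::euclidean_space, 'k::{real_normed_field, euclidean_space}) aefun"
  assumes "f \<in> VMO" shows "scale_aefun c f \<in> VMO"
proof -
  have "\<exists>g\<in>Cc. bmo_seminorm (scale_aefun c f - g) < e" if e: "e > 0" for e
  proof -
    \<comment> \<open>Adding 1 keeps the divisor positive for \<open>c = 0\<close>. Since
      \<open>e\<close> is an \<open>ennreal\<close>, the value infinity is included.\<close>
    have "e / ennreal (norm c + 1) > 0"
      using e by (simp add: ennreal_zero_less_divide)
    then obtain g where g: "g \<in> Cc" "bmo_seminorm (f - g) < e / ennreal (norm c + 1)"
      using assms unfolding VMO_def by blast
    have "bmo_seminorm (scale_aefun c f - scale_aefun c g) = ennreal (norm c) * bmo_seminorm (f - g)"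
      by (simp add: scale_aefun_diff bmo_seminorm_scale)
    also have "\<dots> \<le> ennreal (norm c + 1) * bmo_seminorm (f - g)"
      by (intro mult_right_mono ennreal_leI) auto
    also have "\<dots> < ennreal (norm c + 1) * (e / ennreal (norm c + 1))"
      using g(2) by (intro ennreal_mult_strict_left_mono) (auto simp: add_pos_pos intro: add_nonneg_pos)
    also have "\<dots> = e"
    proof -
      have "ennreal (norm c + 1) \<noteq> 0"
        using norm_ge_zero[of c] by (simp add: add_nonneg_eq_0_iff del: ennreal_plus)
      then show ?thesis
        using ennreal_mult_divide_eq[of "ennreal (norm c + 1)" e]
        by (simp add: ennreal_times_divide mult.commute[of _ e] del: ennreal_plus)
    qed
    finally show ?thesis
      using Cc_scale[OF g(1)] by blast
  qed
  then show ?thesis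
    using assms by (auto simp: VMO_def BMO_scale)
qed

lemma VMO_add:
  fixes f g :: "('a::euclidean_space, 'k::{real_normed_field, euclidean_space}) aefun"
  assumes f: "f \<in> VMO" and g: "g \<in> VMO" shows "f + g \<in> VMO"
proof -
  have "\<exists>h\<in>Cc. bmo_seminorm (f + g - h) < e" if e: "e > 0" for e
  proof -
    have e2: "e / 2 > 0"
      using e by (simp add: ennreal_zero_less_divide)
    obtain u v where u: "u \<in> Cc" "bmo_seminorm (f - u) < e / 2"
      and v: "v \<in> Cc" "bmo_seminorm (g - v) < e / 2"
      using f g e2 unfolding VMO_def by blast
    have Cc_li: "locally_integrable h" if "h \<in> Cc" for h :: "('a, 'k) aefun"
      using that by (auto simp: Cc_def locally_integrable_continuous)
    have "bmo_seminorm ((f - u) + (g - v)) \<le> bmo_seminorm (f - u) + bmo_seminorm (g - v)"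
      using f g Cc_li[OF u(1)] Cc_li[OF v(1)]
      by (intro bmo_seminorm_add locally_integrable_diff) (auto simp: VMO_def BMO_def)
    also have "\<dots> < e / 2 + e / 2"
      using u v by (intro add_strict_mono)
    also have "e / 2 + e / 2 = e"
      using ennreal_mult_divide_eq[of 2 e] by (simp add: mult_2_right add_divide_distrib_ennreal)
    finally show ?thesis
      using Cc_add[OF u(1) v(1)] by (auto simp: algebra_simps intro!: bexI[of _ "u + v"])
  qed
  then show ?thesis
    using f g by (auto simp: VMO_def BMO_add)
qed

lemma Cc_zero: "0 \<in> Cc"
  unfolding Cc_def zero_aefun_def by (intro imageI) auto

lemma VMO_zero: "0 \<in> VMO"
  using Cc_zero
  by (auto simp: VMO_def BMO_def locally_integrable_zero bmo_seminorm_zero intro!: bexI[of _ 0])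

text \<open>Such a function approximates itself with error zero, so only membership in BMO remains,
  and the uniform bound gives it.\<close>

lemma Cc_bounded_imp_VMO:
  fixes g :: "'a::euclidean_space \<Rightarrow> 'k::{real_normed_field, euclidean_space}"
  assumes "continuous_on UNIV g" "compact (closure {x. g x \<noteq> 0})" "\<And>x. norm (g x) \<le> M"
  shows "abs_aefun g \<in> VMO"
  using assms bounded_continuous_BMO(1)[of g M]
  by (auto simp: VMO_def Cc_def bmo_seminorm_zero intro!: bexI[of _ "abs_aefun g"])

text \<open>For the converse, the complement of \<open>K\<close> is one of the open sets whose union
  defines the complement of the support. The right-hand side is the usable form: representatives of
  sums and multiples are known only almost everywhere.\<close>

lemma ess_support_subset_iff:
  assumes "closed K"
  shows "ess_support f \<subseteq> K \<longleftrightarrow> (AE x in lebesgue. x \<notin> K \<longrightarrow> rep_aefun f x = 0)"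
proof
  assume "ess_support f \<subseteq> K"
  then show "AE x in lebesgue. x \<notin> K \<longrightarrow> rep_aefun f x = 0"
    using AE_ess_support[of f] by (auto elim!: eventually_mono)
next
  assume "AE x in lebesgue. x \<notin> K \<longrightarrow> rep_aefun f x = 0"
  then have "- K \<in> {U. open U \<and> (AE x in lebesgue. x \<in> U \<longrightarrow> rep_aefun f x = 0)}"
    using assms by (simp add: open_Compl)
  then show "ess_support f \<subseteq> K"
    unfolding ess_support.rep_eq by blast
qed

lemma AE_rep_plus: "AE x in lebesgue. rep_aefun (f + g) x = rep_aefun f x + rep_aefun g x"
  using rep_abs_aefun[OF borel_measurable_add[OF rep_aefun_measurable[of f] rep_aefun_measurable[of g]]]
  by (simp add: plus_aefun_def)

lemma AE_rep_scale: "AE x in lebesgue. rep_aefun (scale_aefun c f) x = c * rep_aefun f x"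
  using rep_abs_aefun[OF borel_measurable_times[OF borel_measurable_const[of c] rep_aefun_measurable[of f]]]
  by (simp add: scale_aefun_def)

lemma VMO_on_add:
  assumes "closed K" "f \<in> VMO_on K" "g \<in> VMO_on K"
  shows "f + g \<in> VMO_on K"
proof -
  have "AE x in lebesgue. x \<notin> K \<longrightarrow> rep_aefun f x = 0"
    "AE x in lebesgue. x \<notin> K \<longrightarrow> rep_aefun g x = 0"
    using assms by (auto simp: VMO_on_def ess_support_subset_iff)
  then have "AE x in lebesgue. x \<notin> K \<longrightarrow> rep_aefun (f + g) x = 0"
    using AE_rep_plus[of f g] by eventually_elim auto
  then show ?thesis
    using assms by (simp add: VMO_on_def VMO_add ess_support_subset_iff)
qed

lemma VMO_on_scale:
  assumes "closed K" "f \<in> VMO_on K"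
  shows "scale_aefun c f \<in> VMO_on K"
proof -
  have "AE x in lebesgue. x \<notin> K \<longrightarrow> rep_aefun f x = 0"
    using assms by (auto simp: VMO_on_def ess_support_subset_iff)
  then have "AE x in lebesgue. x \<notin> K \<longrightarrow> rep_aefun (scale_aefun c f) x = 0"
    using AE_rep_scale[of c f] by eventually_elim auto
  then show ?thesis
    using assms by (simp add: VMO_on_def VMO_scale ess_support_subset_iff)
qed

lemma VMO_on_mono: "K \<subseteq> L \<Longrightarrow> VMO_on K \<subseteq> VMO_on L"
  by (auto simp: VMO_on_def)

lemma VMO_on_zero: "closed K \<Longrightarrow> 0 \<in> VMO_on K"
  using AE_rep_zero by (simp add: VMO_on_def VMO_zero ess_support_subset_iff) (auto elim: eventually_mono)

lemma Linf_scale: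
  fixes f :: "('a::euclidean_space, 'k::{real_normed_field, euclidean_space}) aefun"
  assumes "f \<in> Linf" shows "scale_aefun c f \<in> Linf"
proof -
  obtain C where "AE x in lebesgue. norm (rep_aefun f x) \<le> C"
    using assms by (auto simp: Linf_def ess_bounded.rep_eq)
  then have "AE x in lebesgue. norm (rep_aefun (scale_aefun c f) x) \<le> norm c * C"
    using AE_rep_scale[of c f] by eventually_elim (auto simp: norm_mult intro: mult_left_mono)
  then show ?thesis
    by (auto simp: Linf_def ess_bounded.rep_eq)
qed

section \<open>The topology of the inductive limit\<close>

text \<open>\<open>enn2real\<close> sends infinity to 0, so the value is meaningful on BMO only;
  hence the membership hypotheses in the triangle inequality.\<close>

definition bmo_norm ::
    "('a::euclidean_space, 'k::{real_normed_field, euclidean_space}) aefun \<Rightarrow> real"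
  where "bmo_norm f = enn2real (bmo_seminorm f)"

definition VMOc_carrier ::
    "(nat \<Rightarrow> 'a set) \<Rightarrow> ('a::euclidean_space, 'k::{real_normed_field, euclidean_space}) aefun set"
  where "VMOc_carrier K = (\<Union>n. VMO_on (K n))"

lemma bmo_norm_nonneg: "0 \<le> bmo_norm f"
  by (simp add: bmo_norm_def)

lemma bmo_norm_scale: "bmo_norm (scale_aefun c f) = norm c * bmo_norm f"
  by (simp add: bmo_norm_def bmo_seminorm_scale enn2real_mult)

lemma bmo_norm_minus_commute: "bmo_norm (f - g) = bmo_norm (g - f)"
  by (simp add: bmo_norm_def bmo_seminorm_minus_commute)

lemma bmo_norm_add: "f \<in> BMO \<Longrightarrow> g \<in> BMO \<Longrightarrow> bmo_norm (f + g) \<le> bmo_norm f + bmo_norm g"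
  unfolding bmo_norm_def using bmo_seminorm_add[of f g]
  by (subst enn2real_plus[symmetric]) (auto simp: BMO_def intro!: enn2real_mono)

lemma uminus_aefun_eq: "- f = scale_aefun (-1) f"
  using scaleR_aefun_eq[of "-1" f] by simp

section \<open>The union of the steps as a space normed by the BMO norm\<close>

lemma compact_exhaustion_mono:
  assumes "compact_exhaustion K" "m \<le> n" shows "K m \<subseteq> K n"
  using assms(2)
proof (rule lift_Suc_mono_le[rotated])
  show "K n \<subseteq> K (Suc n)" for n
    using assms(1) order_trans[OF _ interior_subset] unfolding compact_exhaustion_def by blast
qed

lemma compact_exhaustion_closed: "compact_exhaustion K \<Longrightarrow> closed (K n)"
  for K :: "nat \<Rightarrow> 'a::euclidean_space set"
  by (simp add: compact_exhaustion_def compact_imp_closed)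

text \<open>The steps increase with the exhaustion, so the larger of two indices serves both
  functions. Statements about two elements of the union thereby reduce to one compact set.\<close>

lemma VMOc_carrier_common:
  assumes "compact_exhaustion K" "f \<in> VMOc_carrier K" "g \<in> VMOc_carrier K"
  obtains n where "f \<in> VMO_on (K n)" "g \<in> VMO_on (K n)"
proof -
  obtain i j where "f \<in> VMO_on (K i)" "g \<in> VMO_on (K j)"
    using assms by (auto simp: VMOc_carrier_def)
  then have "f \<in> VMO_on (K (max i j))" "g \<in> VMO_on (K (max i j))"
    using VMO_on_mono[OF compact_exhaustion_mono[OF assms(1)]]
    by (meson max.cobounded1 max.cobounded2 subsetD)+
  then show thesis by (rule that)
qed

lemma VMOc_carrier_add:
  assumes "compact_exhaustion K" "f \<in> VMOc_carrier K" "g \<in> VMOc_carrier K"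
  shows "f + g \<in> VMOc_carrier K"
  using VMOc_carrier_common[OF assms] VMO_on_add[OF compact_exhaustion_closed[OF assms(1)]]
  unfolding VMOc_carrier_def by (metis UN_I UNIV_I)

lemma VMOc_carrier_scale:
  assumes "compact_exhaustion K" "f \<in> VMOc_carrier K"
  shows "scale_aefun c f \<in> VMOc_carrier K"
  using assms VMO_on_scale[OF compact_exhaustion_closed[OF assms(1)]]
  unfolding VMOc_carrier_def by blast

lemma VMOc_carrier_diff:
  assumes "compact_exhaustion K" "f \<in> VMOc_carrier K" "g \<in> VMOc_carrier K"
  shows "f - g \<in> VMOc_carrier K"
  using VMOc_carrier_add[OF assms(1,2) VMOc_carrier_scale[OF assms(1,3), of "-1"]]
  by (simp flip: uminus_aefun_eq)

lemma VMOc_carrier_BMO: "f \<in> VMOc_carrier K \<Longrightarrow> f \<in> BMO"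
  by (auto simp: VMOc_carrier_def VMO_on_def VMO_def)

lemma bmo_norm_triangle:
  assumes "compact_exhaustion K" "f \<in> VMOc_carrier K" "g \<in> VMOc_carrier K" "h \<in> VMOc_carrier K"
  shows "bmo_norm (f - h) \<le> bmo_norm (f - g) + bmo_norm (g - h)"
proof -
  have "f - g \<in> BMO" "g - h \<in> BMO"
    using assms by (auto intro!: VMOc_carrier_BMO[of _ K] VMOc_carrier_diff)
  then show ?thesis
    using bmo_norm_add[of "f - g" "g - h"] by simp
qed

text \<open>Constants are the danger, since the BMO seminorm vanishes on them. Two elements of the
  union share a compact set containing their supports, and there \<open>bmo_dist\<close> is already
  a metric.\<close>

lemma bmo_norm_diff_pos:
  assumes "compact_exhaustion K" "f \<in> VMOc_carrier K" "g \<in> VMOc_carrier K" "f \<noteq> g"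
  shows "0 < bmo_norm (f - g)"
proof -
  obtain n where n: "f \<in> VMO_on (K n)" "g \<in> VMO_on (K n)"
    using VMOc_carrier_common[OF assms(1-3)] .
  interpret Metric_space "VMO_on (K n) :: ('a, 'b) aefun set" bmo_dist
    using assms(1) by (intro Metric_space_VMO_on) (simp add: compact_exhaustion_def)
  have "bmo_dist f g \<noteq> 0"
    using n assms(4) by simp
  then show ?thesis
    using bmo_norm_nonneg[of "f - g"] unfolding bmo_dist_def bmo_norm_def by linarith
qed

section \<open>Neighbourhoods of zero in the steps and open sets in the limit\<close>

lemma topspace_VMO_on_topology:
  "compact K \<Longrightarrow> topspace (VMO_on_topology K) = VMO_on K"
  by (simp add: VMO_on_topology_def Metric_space.topspace_mtopology[OF Metric_space_VMO_on])

lemma zero_nhd_VMO_on_iff: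
  assumes "compact K"
  shows "zero_nhd (VMO_on_topology K) U \<longleftrightarrow>
    U \<subseteq> VMO_on K \<and> (\<exists>e>0. \<forall>f\<in>VMO_on K. bmo_norm f < e \<longrightarrow> f \<in> U)"
proof -
  interpret Metric_space "VMO_on K :: ('a, 'b) aefun set" bmo_dist
    using assms by (rule Metric_space_VMO_on)
  have zero: "(0 :: ('a, 'b) aefun) \<in> VMO_on K"
    using assms by (simp add: VMO_on_zero compact_imp_closed)
  have ball: "f \<in> mball 0 e \<longleftrightarrow> f \<in> VMO_on K \<and> bmo_norm f < e" for f e
    using zero bmo_norm_minus_commute[of 0 f] by (auto simp: bmo_dist_def bmo_norm_def)
  have "(\<exists>W. openin mtopology W \<and> 0 \<in> W \<and> W \<subseteq> U) \<longleftrightarrow> (\<exists>e>0. mball 0 e \<subseteq> U)"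
  proof
    assume "\<exists>W. openin mtopology W \<and> 0 \<in> W \<and> W \<subseteq> U"
    then show "\<exists>e>0. mball 0 e \<subseteq> U"
      unfolding openin_mtopology by (meson order_trans)
  next
    assume "\<exists>e>0. mball 0 e \<subseteq> U"
    then show "\<exists>W. openin mtopology W \<and> 0 \<in> W \<and> W \<subseteq> U"
      using zero centre_in_mball_iff openin_mball by blast
  qed
  moreover have "mball 0 e \<subseteq> U \<longleftrightarrow> (\<forall>f\<in>VMO_on K. bmo_norm f < e \<longrightarrow> f \<in> U)" for e
    using ball[of _ e] by blast
  ultimately show ?thesis
    by (simp add: zero_nhd_def VMO_on_topology_def)
qed

text \<open>The trace on every step is the ball of the same radius \<open>e\<close>, so the
  condition holds for all \<open>n\<close> at once; absolute convexity comes from the seminorm laws.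
  Thus the limit topology is at least as fine as that of the BMO norm.\<close>

lemma bmo_ball_in_lc_limit_base:
  assumes K: "compact_exhaustion K" and e: "e > 0"
  shows "{f \<in> VMOc_carrier K. bmo_norm f < e} \<in>
    lc_limit_base scale_aefun
      (\<lambda>n. VMO_on_topology (K n) :: ('a::euclidean_space, 'k::{real_normed_field, euclidean_space}) aefun topology)"
    (is "?U \<in> _")
proof -
  have cpt: "compact (K n)" for n
    using K by (simp add: compact_exhaustion_def)
  have "convex ?U"
  proof (rule convexI)
    fix f g :: "('a, 'k) aefun" and u v :: real
    assume f: "f \<in> ?U" and g: "g \<in> ?U" and uv: "0 \<le> u" "0 \<le> v" "u + v = 1"
    \<comment> \<open>\<open>convex\<close> refers to real scaling and \<open>balanced\<close> to
      scalars of the field; real multiples are rewritten as field multiples.\<close>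
    have mem: "u *\<^sub>R f \<in> VMOc_carrier K" "v *\<^sub>R g \<in> VMOc_carrier K"
      using f g K by (auto simp: scaleR_aefun_eq VMOc_carrier_scale)
    have "bmo_norm (u *\<^sub>R f + v *\<^sub>R g) \<le> u * bmo_norm f + v * bmo_norm g"
      using bmo_norm_add[OF mem[THEN VMOc_carrier_BMO]] uv
      by (simp add: scaleR_aefun_eq bmo_norm_scale)
    also have "\<dots> < e"
      using f g uv by (intro convex_bound_lt) auto
    finally show "u *\<^sub>R f + v *\<^sub>R g \<in> ?U"
      using mem K by (simp add: VMOc_carrier_add)
  qed
  moreover have "balanced scale_aefun ?U"
  proof -
    have "norm c * bmo_norm f < e" if "norm c \<le> 1" "bmo_norm f < e" for c :: 'k and f :: "('a, 'k) aefun"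
      using that mult_right_mono[OF that(1) bmo_norm_nonneg[of f]] by simp
    then show ?thesis
      using K by (auto simp: balanced_def bmo_norm_scale VMOc_carrier_scale)
  qed
  moreover have "zero_nhd (VMO_on_topology (K n)) (?U \<inter> VMO_on (K n))" for n
    using e by (auto simp: zero_nhd_VMO_on_iff[OF cpt] VMOc_carrier_def)
  ultimately show ?thesis
    by (auto simp: lc_limit_base_def topspace_VMO_on_topology[OF cpt] VMOc_carrier_def)
qed

lemma openin_VMOc_iff:
  assumes "compact_exhaustion K"
  shows "openin (VMOc_topology K) S \<longleftrightarrow> S \<subseteq> VMOc_carrier K \<and>
    (\<forall>f\<in>S. \<exists>U\<in>lc_limit_base scale_aefun (\<lambda>n. VMO_on_topology (K n)). (+) f ` U \<subseteq> S)"
  using assms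
  by (simp add: VMOc_topology_def openin_lc_inductive_limit VMOc_carrier_def compact_exhaustion_def
      topspace_VMO_on_topology)

lemma openin_bmo_ball:
  fixes g :: "('a::euclidean_space, 'k::{real_normed_field, euclidean_space}) aefun"
  assumes K: "compact_exhaustion K" and g: "g \<in> VMOc_carrier K"
  shows "openin (VMOc_topology K) {f \<in> VMOc_carrier K. bmo_norm (f - g) < e}" (is "openin _ ?S")
proof -
  have "\<exists>U\<in>lc_limit_base scale_aefun (\<lambda>n. VMO_on_topology (K n)). (+) f ` U \<subseteq> ?S"
    if f: "f \<in> ?S" for f
  \<comment> \<open>The radius left over at \<open>f\<close> is chosen, so the triangle inequality
    keeps the translate inside the ball about \<open>g\<close>.\<close>
  proof (rule bexI[OF _ bmo_ball_in_lc_limit_base[OF K, of "e - bmo_norm (f - g)"]])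
    show "0 < e - bmo_norm (f - g)"
      using f by simp
    show "(+) f ` {h \<in> VMOc_carrier K. bmo_norm h < e - bmo_norm (f - g)} \<subseteq> ?S"
    proof (clarsimp, intro conjI)
      fix h :: "('a, 'k) aefun"
      assume h: "h \<in> VMOc_carrier K" "bmo_norm h < e - bmo_norm (f - g)"
      show fh: "f + h \<in> VMOc_carrier K"
        using f h K by (simp add: VMOc_carrier_add)
      show "bmo_norm (f + h - g) < e"
        using bmo_norm_triangle[OF K fh _ g, of f] f h by simp
    qed
  qed
  then show ?thesis
    using K by (simp add: openin_VMOc_iff)
qed

text \<open>The carrier of a topology is the union of its open sets, so each point needs an open set
  around it; its unit BMO ball is one.\<close>

lemma topspace_VMOc:
  assumes K: "compact_exhaustion K"
  shows "topspace (VMOc_topology K) = VMOc_carrier K"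
proof
  show "topspace (VMOc_topology K) \<subseteq> VMOc_carrier K"
    using openin_VMOc_iff[OF K] openin_topspace by blast
  show "VMOc_carrier K \<subseteq> topspace (VMOc_topology K)"
  proof
    fix f assume f: "f \<in> VMOc_carrier K"
    then have "f \<in> {h \<in> VMOc_carrier K. bmo_norm (h - f) < 1}"
      by (simp add: bmo_norm_def bmo_seminorm_zero)
    then show "f \<in> topspace (VMOc_topology K)"
      using openin_bmo_ball[OF K f, THEN openin_subset] by blast
  qed
qed

section \<open>Bounded, closed and compact sets in the limit\<close>

lemma tvs_bounded_VMOc_subtopology:
  fixes B :: "('a::euclidean_space, 'k::{real_normed_field, euclidean_space}) aefun set"
  assumes K: "compact_exhaustion K" and B: "B \<subseteq> VMO_on (K N)"
    and bound: "\<And>f. f \<in> B \<Longrightarrow> bmo_norm f \<le> M"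
    and S: "\<And>f c. f \<in> B \<Longrightarrow> scale_aefun c f \<in> S"
  shows "tvs_bounded scale_aefun (subtopology (VMOc_topology K) S) B"
  unfolding tvs_bounded_def
proof (intro conjI allI impI)
  have scale_one: "scale_aefun 1 f = f" for f :: "('a, 'k) aefun"
    using scaleR_aefun_eq[of 1 f] by simp
  \<comment> \<open>Taking \<open>c = 1\<close> in the hypothesis on \<open>S\<close> places
    \<open>B\<close> itself in \<open>S\<close>; general \<open>c\<close> is used below, where
    elements of \<open>B\<close> are shrunk into \<open>U\<close>.\<close>
  show "B \<subseteq> topspace (subtopology (VMOc_topology K) S)"
    using B S[of _ 1] by (auto simp: topspace_VMOc[OF K] VMOc_carrier_def scale_one)
next
  fix U assume "zero_nhd (subtopology (VMOc_topology K) S) U"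
  then obtain W where W: "openin (VMOc_topology K) W" "0 \<in> W" "W \<inter> S \<subseteq> U"
    by (auto simp: zero_nhd_def openin_subtopology)
  then obtain V where V: "V \<in> lc_limit_base scale_aefun (\<lambda>n. VMO_on_topology (K n))" "(+) 0 ` V \<subseteq> W"
    unfolding openin_VMOc_iff[OF K] by blast
  have cpt: "compact (K N)"
    using K by (simp add: compact_exhaustion_def)
  obtain e where e: "e > 0" "\<And>f. f \<in> VMO_on (K N) \<Longrightarrow> bmo_norm f < e \<Longrightarrow> f \<in> V"
    using V(1) by (auto simp: lc_limit_base_def topspace_VMO_on_topology[OF cpt] zero_nhd_VMO_on_iff[OF cpt]
        dest!: spec[of _ N])
  \<comment> \<open>The added 1 turns the bound \<open>M\<close> into a strict inequality, so
    dividing by \<open>c\<close> lands inside the ball of radius \<open>e\<close>; with the absolute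
    value it also makes the threshold positive.\<close>
  have "B \<subseteq> scale_aefun c ` U" if c: "norm c \<ge> (\<bar>M\<bar> + 1) / e" for c
  proof
    fix f assume f: "f \<in> B"
    have "0 < (\<bar>M\<bar> + 1) / e"
      using e by simp
    then have c0: "norm c > 0"
      using c by linarith
    have "bmo_norm f < norm c * e"
      using bound[OF f] c e by (simp add: divide_simps mult.commute)
    then have "bmo_norm (scale_aefun (1 / c) f) < e"
      using c0 by (simp add: bmo_norm_scale norm_divide divide_simps mult.commute)
    then have "scale_aefun (1 / c) f \<in> V"
      using e(2) f B VMO_on_scale[of "K N"] cpt compact_imp_closed by blast
    then have "scale_aefun (1 / c) f \<in> U"
      using V(2) W(3) S[OF f] by auto
    moreover have "f = scale_aefun c (scale_aefun (1 / c) f)"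
      using c0 by transfer auto
    ultimately show "f \<in> scale_aefun c ` U"
      by blast
  qed
  then show "absorbs scale_aefun U B"
    unfolding absorbs_def using e(1) by (intro exI[of _ "(\<bar>M\<bar> + 1) / e"]) (auto intro: divide_pos_pos)
qed

text \<open>By separation at most one element of \<open>B\<close> is closer than
  \<open>d / 2\<close> to a point \<open>g\<close> outside \<open>B\<close>. Its distance to
  \<open>g\<close> is positive and serves as the radius of a ball missing \<open>B\<close>; if there
  is no such element, \<open>d / 2\<close> serves.\<close>

lemma closedin_VMOc_separated:
  assumes K: "compact_exhaustion K" and B: "B \<subseteq> VMOc_carrier K" and d: "d > 0"
    and sep: "\<And>f g. f \<in> B \<Longrightarrow> g \<in> B \<Longrightarrow> f \<noteq> g \<Longrightarrow> d \<le> bmo_norm (f - g)"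
  shows "closedin (VMOc_topology K) B"
  unfolding closedin_def topspace_VMOc[OF K]
proof (intro conjI B)
  have "\<exists>T. openin (VMOc_topology K) T \<and> g \<in> T \<and> T \<subseteq> VMOc_carrier K - B"
    if g: "g \<in> VMOc_carrier K - B" for g
  proof -
    have self: "bmo_norm (g - g) = 0"
      by (simp add: bmo_norm_def bmo_seminorm_zero)
    obtain e where e: "e > 0" "\<And>f. f \<in> B \<Longrightarrow> e \<le> bmo_norm (f - g)"
    proof (cases "\<exists>f\<in>B. bmo_norm (f - g) < d / 2")
      case True
      then obtain f where f: "f \<in> B" "bmo_norm (f - g) < d / 2"
        by blast
      show thesis
      proof (rule that)
        show "0 < bmo_norm (f - g)"
          using f g B by (intro bmo_norm_diff_pos[OF K]) auto
        fix h assume h: "h \<in> B"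
        show "bmo_norm (f - g) \<le> bmo_norm (h - g)"
        proof (cases "h = f")
          case False
          have "d \<le> bmo_norm (h - g) + bmo_norm (g - f)"
            using sep[OF h f(1) False] bmo_norm_triangle[OF K, of h g f] h f g B
            by (meson DiffD1 order_trans subsetD)
          then show ?thesis
            using f(2) by (simp add: bmo_norm_minus_commute)
        qed simp
      qed
    qed (use d in \<open>auto simp: not_less intro: that[of "d / 2"]\<close>)
    show ?thesis
      using g e self openin_bmo_ball[OF K, of g e]
      by (intro exI[of _ "{f \<in> VMOc_carrier K. bmo_norm (f - g) < e}"]) (auto dest: leD)
  qed
  then show "openin (VMOc_topology K) (VMOc_carrier K - B)"
    by (subst openin_subopen) blast
qed

text \<open>A ball of radius \<open>d\<close> about a point of \<open>B\<close> meets
  \<open>B\<close> in its centre only, so the centres of a finite subcover exhaust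
  \<open>B\<close>.\<close>

lemma compactin_VMOc_separated_imp_finite:
  fixes B :: "('a::euclidean_space, 'k::{real_normed_field, euclidean_space}) aefun set"
  assumes K: "compact_exhaustion K" and B: "compactin (VMOc_topology K) B" and d: "d > 0"
    and sep: "\<And>f g. f \<in> B \<Longrightarrow> g \<in> B \<Longrightarrow> f \<noteq> g \<Longrightarrow> d \<le> bmo_norm (f - g)"
  shows "finite B"
proof -
  define T where "T g = {f \<in> VMOc_carrier K. bmo_norm (f - g) < d}" for g :: "('a, 'k) aefun"
  have sub: "B \<subseteq> VMOc_carrier K"
    using compactin_subset_topspace[OF B] by (simp add: topspace_VMOc[OF K])
  have "\<forall>U\<in>T ` B. openin (VMOc_topology K) U"
    using openin_bmo_ball[OF K] sub by (auto simp: T_def)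
  moreover have "B \<subseteq> \<Union> (T ` B)"
    using sub d by (auto simp: T_def bmo_norm_def bmo_seminorm_zero)
  ultimately obtain \<F> where "finite \<F>" "\<F> \<subseteq> T ` B" "B \<subseteq> \<Union>\<F>"
    using B unfolding compactin_def by meson
  then obtain C where C: "finite C" "C \<subseteq> B" "B \<subseteq> \<Union> (T ` C)"
    by (metis finite_subset_image)
  have "B \<subseteq> C"
  proof
    fix f assume f: "f \<in> B"
    then obtain g where g: "g \<in> C" "bmo_norm (f - g) < d"
      using C by (auto simp: T_def)
    then show "f \<in> C"
      using sep[of f g] f C(2) by (metis not_le subsetD)
  qed
  then show ?thesis
    using C(1) finite_subset by blast
qed

section \<open>A separated sequence of dilated bumps\<close>

text \<open>A radial trapezoid: 1 up to radius \<open>r\<close>, 0 from \<open>2 * r\<close> on,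
  linear in between. For positive \<open>r\<close> it is the dilate of \<open>bump 1\<close>;
  \<open>of_real\<close> serves real and complex scalars alike.\<close>

definition bump :: "real \<Rightarrow> 'a::real_normed_vector \<Rightarrow> 'k::real_normed_field"
  where "bump r x = of_real (max 0 (min 1 (2 - norm x / r)))"

lemma bump_eq_1: "0 < r \<Longrightarrow> norm x \<le> r \<Longrightarrow> bump r x = 1"
  by (simp add: bump_def divide_simps min_def)

lemma bump_eq_0: "0 < r \<Longrightarrow> 2 * r \<le> norm x \<Longrightarrow> bump r x = 0"
  by (simp add: bump_def field_simps max_def min_def)

lemma norm_bump_le_1: "norm (bump r x :: 'k::real_normed_field) \<le> 1"
  by (simp add: bump_def)

lemma continuous_on_bump: "continuous_on S (bump r :: _ \<Rightarrow> 'k::real_normed_field)"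
  \<comment> \<open>Multiplying by \<open>inverse r\<close> is continuous for every
    \<open>r\<close>, so no side condition \<open>r \<noteq> 0\<close> arises.\<close>
  unfolding bump_def divide_inverse by (intro continuous_intros)

lemma bump_measurable:
  "(bump r :: 'a::euclidean_space \<Rightarrow> 'k::{real_normed_field, euclidean_space}) \<in> borel_measurable lebesgue"
  by (rule continuous_imp_borel_measurable_lebesgue[OF continuous_on_bump])

lemma abs_bump_VMO_on:
  assumes r: "0 < r" and K: "closed K" "cball 0 (2 * r) \<subseteq> K"
  shows "abs_aefun (bump r :: 'a::euclidean_space \<Rightarrow> 'k::{real_normed_field, euclidean_space}) \<in> VMO_on K"
proof -
  have sub: "{x. bump r x \<noteq> (0::'k)} \<subseteq> cball (0::'a) (2 * r)"
  proof
    fix x :: 'a assume "x \<in> {x. bump r x \<noteq> (0::'k)}"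
    then show "x \<in> cball 0 (2 * r)"
      using bump_eq_0[OF r, of x] by (cases "2 * r \<le> norm x") auto
  qed
  have "compact (closure {x::'a. bump r x \<noteq> (0::'k)})"
    by (rule compact_closure_subset[OF _ sub]) simp
  moreover have "AE x in lebesgue. x \<notin> K \<longrightarrow> rep_aefun (abs_aefun (bump r :: 'a \<Rightarrow> 'k)) x = 0"
    using rep_abs_aefun[OF bump_measurable[where 'a = 'a and 'k = 'k, of r]]
  proof eventually_elim
    case (elim x)
    then show ?case
      using sub K(2) by (cases "bump r x = (0::'k)") auto
  qed
  ultimately show ?thesis
    using Cc_bounded_imp_VMO[OF continuous_on_bump _ norm_bump_le_1]
    by (simp add: VMO_on_def ess_support_subset_iff K)
qed

lemma abs_bump_Linf:
  "abs_aefun (bump r :: 'a::euclidean_space \<Rightarrow> 'k::{real_normed_field, euclidean_space}) \<in> Linf"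
  using norm_bump_le_1 by (auto simp: Linf_def ess_bounded.abs_eq bump_measurable intro!: exI[of _ 1])

lemma bmo_norm_abs_bump:
  "bmo_norm (abs_aefun (bump r :: 'a::euclidean_space \<Rightarrow> 'k::{real_normed_field, euclidean_space})) \<le> 2"
  using enn2real_mono[OF bounded_continuous_BMO(2)[OF continuous_on_bump norm_bump_le_1]]
  by (simp add: bmo_norm_def)

text \<open>
  On the ball of radius \<open>4 s\<close> the difference of the bumps is \<open>0\<close> on a ball of radius \<open>s\<close> and \<open>1\<close> on
  another one, and no constant is close to both values.
\<close>

lemma mean_oscillation_bump_diff:
  fixes r s :: real
  assumes s: "0 < s" and rs: "4 * s \<le> r"
  defines "h \<equiv> abs_aefun (bump r :: 'a::euclidean_space \<Rightarrow> 'k::{real_normed_field, euclidean_space}) -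
    abs_aefun (bump s)"
  shows "(1 / 4) ^ DIM('a) \<le> mean_oscillation h 0 (4 * s)"
proof -
  define w where "w = (\<lambda>x::'a. bump r x - bump s x :: 'k)"
  have w_meas: "w \<in> borel_measurable lebesgue"
    unfolding w_def by (intro borel_measurable_diff bump_measurable)
  have h: "h = abs_aefun w"
    unfolding h_def w_def by (rule minus_aefun_abs) (rule bump_measurable)+
  obtain b :: 'a where b: "b \<in> Basis"
    using nonempty_Basis by blast
  \<comment> \<open>A ball of radius \<open>s\<close> centred at distance \<open>3 * s\<close> fits
    between the radii \<open>2 * s\<close> and \<open>4 * s\<close>. There \<open>bump s\<close> has
    already vanished, while \<open>bump r\<close> is still 1 because \<open>4 * s \<le> r\<close>:
    this is the origin of the factor 4.\<close>
  define B1 B2 B where "B1 = ball (0::'a) s" and "B2 = ball ((3 * s) *\<^sub>R b) s" and "B = ball (0::'a) (4 * s)"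
  have nb: "norm ((3 * s) *\<^sub>R b) = 3 * s"
    using b s by simp
  have B2: "2 * s \<le> norm x \<and> norm x < 4 * s" if "x \<in> B2" for x
  proof -
    have "norm ((3 * s) *\<^sub>R b - x) < s"
      using that by (simp add: B2_def dist_norm)
    then show ?thesis
      using norm_triangle_ineq2[of "(3 * s) *\<^sub>R b" x] norm_triangle_ineq2[of x "(3 * s) *\<^sub>R b"] nb
      by (auto simp: norm_minus_commute)
  qed
  have w0: "w x = 0" if "x \<in> B1" for x
    using that s rs by (simp add: w_def B1_def bump_eq_1)
  have w1: "w x = 1" if "x \<in> B2" for x
    using B2[OF that] s rs by (simp add: w_def bump_eq_1 bump_eq_0)
  define c where "c = ball_mean w 0 (4 * s)"
  define m where "m = s ^ DIM('a) * measure lebesgue (ball (0::'a) 1)"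
  have m1: "measure lebesgue B1 = m" and m2: "measure lebesgue B2 = m"
    and mB: "measure lebesgue B = 4 ^ DIM('a) * m"
    using s content_ball_conv_unit_ball[of s "0::'a"] content_ball_conv_unit_ball[of s "(3 * s) *\<^sub>R b"]
      content_ball_conv_unit_ball[of "4 * s" "0::'a"]
    by (simp_all add: B1_def B2_def B_def m_def power_mult_distrib)
  have m_pos: "m > 0"
    using s content_ball_pos[of 1 "0::'a"] by (simp add: m_def)
  have ind: "integrable lebesgue (indicat_real B1)" "integrable lebesgue (indicat_real B2)"
    unfolding B1_def B2_def using emeasure_lborel_ball_finite
    by (auto intro!: integrable_real_indicator)
  have int: "integrable lebesgue (\<lambda>x. indicat_real B1 x * norm c + indicat_real B2 x * norm (1 - c))"
    using ind by (intro Bochner_Integration.integrable_add integrable_mult_left)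
  have li: "w absolutely_integrable_on B"
    using locally_integrable_continuous[of w] w_meas unfolding B_def
    by (intro absolutely_integrable_on_ball)
      (simp add: locally_integrable.abs_eq w_def continuous_on_diff continuous_on_bump)
  have "m \<le> m * norm c + m * norm (1 - c)"
  proof -
    have "1 \<le> norm c + norm (1 - c)"
      using norm_triangle_ineq[of c "1 - c"] by simp
    then show ?thesis
      using m_pos by (simp flip: distrib_left)
  qed
  also have "\<dots> = (\<integral>x. indicat_real B1 x * norm c + indicat_real B2 x * norm (1 - c) \<partial>lebesgue)"
    using ind by (subst Bochner_Integration.integral_add) (auto simp: m1 m2)
  also have "\<dots> \<le> (LINT x:B|lebesgue. norm (w x - c))"
    unfolding set_lebesgue_integral_def
  proof (rule integral_mono[OF int])
    show "integrable lebesgue (\<lambda>x. indicat_real B x *\<^sub>R norm (w x - c))"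
      using set_integrable_norm[OF absolutely_integrable_on_ball_diff_const[OF li[unfolded B_def], of c]]
      by (simp add: set_integrable_def B_def)
    \<comment> \<open>\<open>B1\<close> and \<open>B2\<close> are disjoint subsets of
      \<open>B\<close>, so at most one summand is nonzero at a point, and there it equals the
      right-hand side.\<close>
    show "indicat_real B1 x * norm c + indicat_real B2 x * norm (1 - c) \<le>
        indicat_real B x *\<^sub>R norm (w x - c)" for x
    proof -
      have "x \<in> B1 \<Longrightarrow> x \<in> B \<and> x \<notin> B2" "x \<in> B2 \<Longrightarrow> x \<in> B"
        using s B2[of x] by (auto simp: B1_def B_def)
      then show ?thesis
        using w0[of x] w1[of x] by (auto simp: indicator_def)
    qed
  qed
  finally have "m / measure lebesgue B \<le> mean_oscillation h 0 (4 * s)"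
    using w_meas unfolding h by (simp add: mean_oscillation.abs_eq c_def B_def divide_right_mono)
  \<comment> \<open>\<open>B\<close> has \<open>4 ^ DIM('a)\<close> times the volume
    \<open>m\<close> of the small balls, so the scale \<open>s\<close> cancels.\<close>
  then show ?thesis
    using m_pos by (simp add: mB power_divide)
qed

section \<open>Separation in the BMO norm and failure of the Montel property\<close>

lemma mean_oscillation_le_bmo_norm:
  assumes "f \<in> BMO" "0 < r"
  shows "mean_oscillation f a r \<le> bmo_norm f"
proof -
  have "ennreal (mean_oscillation f a r) \<le> bmo_seminorm f"
    unfolding bmo_seminorm_def using assms(2)
    by (intro SUP_upper2[of a] SUP_upper2[of r]) auto
  then have "enn2real (ennreal (mean_oscillation f a r)) \<le> bmo_norm f"
    unfolding bmo_norm_def using assms(1) by (intro enn2real_mono) (auto simp: BMO_def)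
  then show ?thesis
    by (simp add: mean_oscillation_nonneg)
qed

lemma VMOc_bounded_separated_sequence:
  fixes K :: "nat \<Rightarrow> 'a::euclidean_space set"
  assumes K: "compact_exhaustion K"
  obtains F :: "nat \<Rightarrow> ('a, 'k::{real_normed_field, euclidean_space}) aefun" and N d
  where "range F \<subseteq> VMO_on (K N) \<inter> Linf" "\<And>n. bmo_norm (F n) \<le> 2" "d > 0"
    "\<And>m n. m \<noteq> n \<Longrightarrow> d \<le> bmo_norm (F m - F n)"
proof -
  obtain n where "0 \<in> K n"
    using K by (metis UNIV_I UN_E compact_exhaustion_def)
  then have "0 \<in> interior (K (Suc n))"
    using K by (auto simp: compact_exhaustion_def)
  then obtain e where e: "e > 0" "cball 0 e \<subseteq> K (Suc n)"
    by (auto simp: mem_interior_cball)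
  \<comment> \<open>Successive ratios of 4 meet the separation estimate. The exponent starts at 1
    because the support radius \<open>2 * r i\<close> must not exceed \<open>e\<close>.\<close>
  define r where "r i = e / 4 ^ Suc i" for i :: nat
  define F where "F i = abs_aefun (bump (r i) :: 'a \<Rightarrow> 'k)" for i
  have r: "0 < r i" "2 * r i \<le> e" for i
  proof -
    have "(1::real) \<le> 2 * 4 ^ i"
      using one_le_power[of "4::real" i] by linarith
    then show "0 < r i" "2 * r i \<le> e"
      using e by (auto simp: r_def divide_simps)
  qed
  have F: "F i \<in> VMO_on (K (Suc n))" for i
    unfolding F_def using r[of i] e
    by (intro abs_bump_VMO_on compact_exhaustion_closed K) auto
  have sep: "(1 / 4) ^ DIM('a) \<le> bmo_norm (F i - F j)" if "i < j" for i j
  proof -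
    have "4 * r j \<le> r i"
    proof -
      have "(4::real) ^ Suc i \<le> 4 ^ j"
        using that by (intro power_increasing) auto
      then show ?thesis
        using e by (simp add: r_def divide_simps)
    qed
    then have "(1 / 4) ^ DIM('a) \<le> mean_oscillation (F i - F j) 0 (4 * r j)"
      unfolding F_def using r by (intro mean_oscillation_bump_diff)
    also have "\<dots> \<le> bmo_norm (F i - F j)"
      using F r VMOc_carrier_diff[OF K, of "F i" "F j"]
      by (intro mean_oscillation_le_bmo_norm VMOc_carrier_BMO[of _ K]) (auto simp: VMOc_carrier_def)
    finally show ?thesis .
  qed
  show thesis
  proof (rule that)
    show "range F \<subseteq> VMO_on (K (Suc n)) \<inter> Linf"
      using F abs_bump_Linf by (auto simp: F_def)
    show "bmo_norm (F i) \<le> 2" for i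
      by (simp add: F_def bmo_norm_abs_bump)
    show "(0::real) < (1 / 4) ^ DIM('a)"
      by simp
    show "(1 / 4) ^ DIM('a) \<le> bmo_norm (F i - F j)" if "i \<noteq> j" for i j
      using sep[of i j] sep[of j i] that by (auto simp: bmo_norm_minus_commute neq_iff)
  qed
qed

text \<open>One statement serves the whole space and the subspace. A closed set contained in
  \<open>S\<close> stays closed in the subspace, and its compactness does not depend on the ambient
  space. Containing \<open>Linf\<close> guarantees that \<open>S\<close> holds all multiples of the
  bumps.\<close>

lemma not_Montel_property_VMOc_subtopology:
  fixes S :: "('a::euclidean_space, 'k::{real_normed_field, euclidean_space}) aefun set"
  assumes K: "compact_exhaustion K" and "Linf \<subseteq> S"
  shows "\<not> Montel_property scale_aefun (subtopology (VMOc_topology K) S)"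
proof -
  obtain F :: "nat \<Rightarrow> ('a, 'k) aefun" and N d
    where F: "range F \<subseteq> VMO_on (K N) \<inter> Linf" and bound: "\<And>n. bmo_norm (F n) \<le> 2"
      and d: "d > 0" and sep: "\<And>m n. m \<noteq> n \<Longrightarrow> d \<le> bmo_norm (F m - F n)"
    using VMOc_bounded_separated_sequence[OF K] by metis
  let ?B = "range F"
  have sepB: "d \<le> bmo_norm (f - g)" if "f \<in> ?B" "g \<in> ?B" "f \<noteq> g" for f g
    using that by (auto intro!: sep)
  have "inj F"
    using sep d by (intro injI) (metis bmo_norm_def bmo_seminorm_zero cancel_comm_monoid_add_class.diff_cancel
        enn2real_0 not_le)
  then have "infinite ?B"
    by (simp add: range_inj_infinite)
  then have "\<not> compactin (VMOc_topology K) ?B"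
    using compactin_VMOc_separated_imp_finite[OF K _ d sepB] by blast
  moreover have "closedin (VMOc_topology K) ?B"
    using F by (intro closedin_VMOc_separated[OF K _ d sepB]) (auto simp: VMOc_carrier_def)
  then have "closedin (subtopology (VMOc_topology K) S) ?B"
    using F assms(2) by (intro closedin_subset_topspace) auto
  moreover have "tvs_bounded scale_aefun (subtopology (VMOc_topology K) S) ?B"
  proof (rule tvs_bounded_VMOc_subtopology[OF K])
    show "?B \<subseteq> VMO_on (K N)"
      using F by blast
    show "scale_aefun c f \<in> S" if "f \<in> ?B" for f c
      using that F assms(2) Linf_scale by blast
  qed (use bound in auto)
  ultimately show ?thesis
    by (auto simp: Montel_property_def compactin_subtopology)
qed

theorem proposition25:
  fixes K :: "nat \<Rightarrow> (real ^ 'd) set"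
    and VMOc :: "(real ^ 'd, 'k::{real_normed_field, euclidean_space}) aefun topology"
  assumes "compact_exhaustion K"
    and "VMOc = VMOc_topology K"
  shows "\<not> Montel_property scale_aefun VMOc \<and> \<not> Montel_space scale_aefun VMOc \<and>
         \<not> Montel_property scale_aefun (subtopology VMOc Linf) \<and>
         \<not> Montel_space scale_aefun (subtopology VMOc Linf)"
proof -
  \<comment> \<open>The choice \<open>S = UNIV\<close> recovers the full topology.\<close>
  have "\<not> Montel_property scale_aefun VMOc" "\<not> Montel_property scale_aefun (subtopology VMOc Linf)"
    using not_Montel_property_VMOc_subtopology[OF assms(1), of UNIV]
      not_Montel_property_VMOc_subtopology[OF assms(1), of Linf] assms(2) by auto
  then show ?thesis
    by (simp add: Montel_space_def)
qed

end
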